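(* Let $X=\prod_{i=1}^n\{0,\dots,m_i\}$, $f\colon X\to X$, and $F=\beta\circ f\circ\beta^{-1}\circ\psi\colon\{0,1\}^m\to\{0,1\}^m$. (i) If for some $y\in\{0,1\}^m$ the local interaction graph $G_F(y)$ contains a cycle, then $G_f(x)$ contains a cycle, where $x=\beta^{-1}(\psi(y))$; moreover, if the cycle in $G_F(y)$ is negative, then $G_f(x)$ contains a negative cycle. (ii) If the global interaction graph $G_F$ contains a cycle, then the global interaction graph $G_f$ contains a cycle; moreover, if the cycle in $G_F$ is negative, then $G_f$ contains a negative cycle.
   Context: $m_i\ge1$, $m=\sum_i m_i$; coordinates of $\{0,1\}^m$ are indexed by $I=\{(i,j)\mid 1\le i\le n,\,1\le j\le m_i\}$. $\beta\colon X\to\{0,1\}^m$ is given by $\beta_{i,j}(x)=1$ iff $x_i\ge j$; $\mathcal{A}=\beta(X)$ and $\beta^{-1}$ is the inverse of $\beta\colon X\to\mathcal{A}$. $\psi\colon\{0,1\}^m\to\mathcal{A}$ is defined by $\psi_{i,j}(y)=1$ iff $\sum_{k=1}^{m_i}y_{i,k}\ge j$. $e^k$ is the $k$-th unit vector, $\mathrm{sign}(0)=0$. For a map $g\colon Y\to Y$, $Y$ a set of integer vectors with coordinates indexed by a finite set $J$, the local interaction graph $G_g(x)$ at $x\in Y$ has vertex set $J$ and an edge from $j$ to $i$ with sign $s=s_1\,\mathrm{sign}(g_i(x+s_1e^j)-g_i(x))$ whenever $s_1\in\{-1,1\}$, $x+s_1e^j\in Y$ and $s\ne0$. The global interaction graph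 $G_g$ has an edge $j\to i$ of sign $s$ iff some $G_g(x)$ has such an edge. Cycles are elementary directed cycles (loops allowed); the sign of a cycle is the product of its edge signs. *)

theory Defs
  imports "HOL-Library.FuncSet" "Graph_Theory.Arc_Walk"
begin

text \<open>
  Integer vectors with coordinates indexed by a set \<open>J\<close> are functions \<open>'j \<Rightarrow> int\<close> that are
  \<^const>\<open>undefined\<close> outside \<open>J\<close>, so that the product sets below are instances of \<^const>\<open>PiE\<close>.
\<close>

definition unit_vector :: "'j \<Rightarrow> 'j \<Rightarrow> int" where
  "unit_vector j = (\<lambda>k. if k = j then 1 else 0)"

definition shift :: "'j set \<Rightarrow> ('j \<Rightarrow> int) \<Rightarrow> int \<Rightarrow> 'j \<Rightarrow> ('j \<Rightarrow> int)" where
  "shift J x s j = (\<lambda>k\<in>J. x k + s * unit_vector j k)"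

text \<open>
  A signed arc is a triple of tail, sign and head; a positive and a negative arc between the same
  two vertices may coexist. The parameter \<open>Y\<close> is the domain of \<open>g\<close>; values of \<open>g\<close> outside \<open>Y\<close> do
  not matter for \<open>x \<in> Y\<close>.
\<close>

type_synonym 'j signed_digraph = "('j, 'j \<times> int \<times> 'j) pre_digraph"

definition local_interaction_graph ::
  "'j set \<Rightarrow> ('j \<Rightarrow> int) set \<Rightarrow> (('j \<Rightarrow> int) \<Rightarrow> ('j \<Rightarrow> int)) \<Rightarrow> ('j \<Rightarrow> int) \<Rightarrow> 'j signed_digraph"
where
  "local_interaction_graph J Y g x =
     \<lparr> verts = J,
       arcs = {(j, s, i). j \<in> J \<and> i \<in> J \<and>
                 (\<exists>s1\<in>{-1, 1}. shift J x s1 j \<in> Y \<and>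
                    s = s1 * sgn (g (shift J x s1 j) i - g x i) \<and> s \<noteq> 0)},
       tail = (\<lambda>(j, s, i). j),
       head = (\<lambda>(j, s, i). i) \<rparr>"

definition global_interaction_graph ::
  "'j set \<Rightarrow> ('j \<Rightarrow> int) set \<Rightarrow> (('j \<Rightarrow> int) \<Rightarrow> ('j \<Rightarrow> int)) \<Rightarrow> 'j signed_digraph"
where
  "global_interaction_graph J Y g =
     \<lparr> verts = J,
       arcs = (\<Union>x\<in>Y. arcs (local_interaction_graph J Y g x)),
       tail = (\<lambda>(j, s, i). j),
       head = (\<lambda>(j, s, i). i) \<rparr>"

text \<open>
  \<^const>\<open>pre_digraph.cycle\<close> describes elementary directed cycles, given by their (nonempty) list of
  arcs; loops are allowed.
\<close>

definition has_cycle :: "'j signed_digraph \<Rightarrow> bool" where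
  "has_cycle G \<longleftrightarrow> (\<exists>p. pre_digraph.cycle G p)"

definition cycle_sign :: "('j \<times> int \<times> 'j) list \<Rightarrow> int" where
  "cycle_sign p = prod_list (map (\<lambda>(j, s, i). s) p)"

definition has_negative_cycle :: "'j signed_digraph \<Rightarrow> bool" where
  "has_negative_cycle G \<longleftrightarrow> (\<exists>p. pre_digraph.cycle G p \<and> cycle_sign p = -1)"

definition state_space :: "nat \<Rightarrow> (nat \<Rightarrow> nat) \<Rightarrow> (nat \<Rightarrow> int) set" where
  "state_space n m = (\<Pi>\<^sub>E i\<in>{1..n}. {0..int (m i)})"

definition bool_index :: "nat \<Rightarrow> (nat \<Rightarrow> nat) \<Rightarrow> (nat \<times> nat) set" where
  "bool_index n m = (SIGMA i:{1..n}. {1..m i})"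

definition bool_space :: "nat \<Rightarrow> (nat \<Rightarrow> nat) \<Rightarrow> (nat \<times> nat \<Rightarrow> int) set" where
  "bool_space n m = (\<Pi>\<^sub>E p\<in>bool_index n m. {0, 1})"

definition beta :: "nat \<Rightarrow> (nat \<Rightarrow> nat) \<Rightarrow> (nat \<Rightarrow> int) \<Rightarrow> (nat \<times> nat \<Rightarrow> int)" where
  "beta n m x = restrict (\<lambda>(i, j). if x i \<ge> int j then 1 else 0) (bool_index n m)"

definition admissible :: "nat \<Rightarrow> (nat \<Rightarrow> nat) \<Rightarrow> (nat \<times> nat \<Rightarrow> int) set" where
  "admissible n m = beta n m ` state_space n m"

definition beta_inv :: "nat \<Rightarrow> (nat \<Rightarrow> nat) \<Rightarrow> (nat \<times> nat \<Rightarrow> int) \<Rightarrow> (nat \<Rightarrow> int)" where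
  "beta_inv n m = inv_into (state_space n m) (beta n m)"

definition psi :: "nat \<Rightarrow> (nat \<Rightarrow> nat) \<Rightarrow> (nat \<times> nat \<Rightarrow> int) \<Rightarrow> (nat \<times> nat \<Rightarrow> int)" where
  "psi n m y =
     restrict (\<lambda>(i, j). if (\<Sum>k=1..m i. y (i, k)) \<ge> int j then 1 else 0) (bool_index n m)"

definition boolean_map ::
  "nat \<Rightarrow> (nat \<Rightarrow> nat) \<Rightarrow> ((nat \<Rightarrow> int) \<Rightarrow> (nat \<Rightarrow> int)) \<Rightarrow> (nat \<times> nat \<Rightarrow> int) \<Rightarrow> (nat \<times> nat \<Rightarrow> int)"
where
  "boolean_map n m f = beta n m \<circ> f \<circ> beta_inv n m \<circ> psi n m"

lemma bij_betw_beta: "bij_betw (beta n m) (state_space n m) (admissible n m)"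
proof -
  have "x = x'"
    if x: "x \<in> state_space n m" and x': "x' \<in> state_space n m" and eq: "beta n m x = beta n m x'"
    for x x'
  proof (rule PiE_ext[OF x[unfolded state_space_def] x'[unfolded state_space_def]])
    fix i assume i: "i \<in> {1..n}"
    have bnd: "0 \<le> x i" "x i \<le> int (m i)" "0 \<le> x' i" "x' i \<le> int (m i)"
      using x x' i by (auto simp: state_space_def PiE_iff)
    have *: "x i \<ge> int j \<longleftrightarrow> x' i \<ge> int j" if "1 \<le> j" "j \<le> m i" for j
    proof -
      have "(i, j) \<in> bool_index n m" using i that by (auto simp: bool_index_def)
      then show ?thesis using fun_cong[OF eq, of "(i, j)"] by (auto simp: beta_def split: if_splits)
    qed
    show "x i = x' i"
    proof (rule antisym)
      show "x i \<le> x' i"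
        using *[of "nat (x i)"] bnd by (cases "x i = 0") (simp, linarith)
      show "x' i \<le> x i"
        using *[of "nat (x' i)"] bnd by (cases "x' i = 0") (simp, linarith)
    qed
  qed
  then show ?thesis by (auto simp: bij_betw_def inj_on_def admissible_def)
qed

lemma psi_eq_beta: "psi n m y = beta n m (\<lambda>i\<in>{1..n}. \<Sum>k=1..m i. y (i, k))"
  by (rule ext) (auto simp: psi_def beta_def bool_index_def restrict_def)

lemma row_sums_in_state_space:
  assumes "y \<in> bool_space n m"
  shows "(\<lambda>i\<in>{1..n}. \<Sum>k=1..m i. y (i, k)) \<in> state_space n m"
proof -
  have "y (i, k) \<in> {0, 1}" if "i \<in> {1..n}" "k \<in> {1..m i}" for i k
    using assms that by (auto simp: bool_space_def bool_index_def PiE_iff)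
  then have "0 \<le> y (i, k) \<and> y (i, k) \<le> 1" if "i \<in> {1..n}" "k \<in> {1..m i}" for i k
    using that by fastforce
  then have "0 \<le> (\<Sum>k=1..m i. y (i, k)) \<and> (\<Sum>k=1..m i. y (i, k)) \<le> int (m i)"
    if "i \<in> {1..n}" for i
    using that sum_bounded_above[of "{1..m i}" "\<lambda>k. y (i, k)" 1] by (auto intro: sum_nonneg)
  then show ?thesis by (auto simp: state_space_def PiE_iff)
qed

lemma psi_in_admissible: "y \<in> bool_space n m \<Longrightarrow> psi n m y \<in> admissible n m"
  unfolding psi_eq_beta admissible_def by (rule imageI) (rule row_sums_in_state_space)

lemma admissible_subset_bool_space: "admissible n m \<subseteq> bool_space n m"
  by (auto simp: admissible_def bool_space_def beta_def split: if_splits)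

end

theory Submission
  imports Defs
begin

text \<open>
  Identify each vertex \<open>(i, j)\<close> with \<open>i\<close>. Flipping one bit of \<open>y\<close> in row \<open>i\<close> moves the row sums
  \<open>x = \<beta>\<^sup>-\<^sup>1(\<psi>(y))\<close> by the corresponding unit step in direction \<open>i\<close>, and \<open>F\<close> thresholds \<open>f(x)\<close>
  monotonically, so arcs of the Boolean interaction graph project to arcs of the original one with
  the same sign. A cycle thus projects to a closed walk of the same sign, which splits into
  elementary cycles; if the product of their signs is negative, one of them is negative.
\<close>

text \<open>Strong induction on the length: a repeated vertex cuts the walk into two shorter
  nonempty closed walks. Keeping negativity as an implication inside the existential lets one
  induction serve both cycles and negative cycles.\<close>

lemma (in wf_digraph) closed_walk_imp_cycle_sign:
  fixes w :: "'b \<Rightarrow> int"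
  assumes "awalk u p u" and "p \<noteq> []" and "\<And>a. a \<in> set p \<Longrightarrow> w a \<in> {1, -1}"
  shows "\<exists>c. cycle c \<and> (prod_list (map w p) = -1 \<longrightarrow> prod_list (map w c) = -1)"
  using assms
proof (induction "length p" arbitrary: u p rule: less_induct)
  case less
  show ?case
  proof (cases "distinct (tl (awalk_verts u p))")
    case True
    then show ?thesis using less.prems by (auto simp: cycle_def)
  next
    case False
    \<comment> \<open>\<open>cycle\<close> asks for distinctness only after the first vertex, that
      is, along \<open>es\<close> started at the head of \<open>e\<close>. Searching for the
      repetition in \<open>es\<close> keeps \<open>e\<close> out of the excised part
      \<open>r\<close>, so the remainder \<open>e # q @ s\<close> is nonempty even if
      \<open>q\<close> and \<open>s\<close> are empty.\<close>
    obtain e es where p: "p = e # es" using less.prems(2) by (cases p) auto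
    have es: "awalk (head G e) es u" and e: "e \<in> arcs G" "tail G e = u"
      using less.prems(1) by (auto simp: p awalk_Cons_iff)
    have "\<not> distinct (awalk_verts (head G e) es)" using False by (simp add: p)
    then obtain q r s v where qrs: "es = q @ r @ s" "r \<noteq> []"
      and q: "awalk (head G e) q v" and v: "awalk v r v" and s: "awalk v s u"
      using awalk_not_distinct_decomp[OF es] by auto
    have qs: "awalk (head G e) (q @ s) u" by (rule awalk_appendI[OF q s])
    let ?t = "e # q @ s"
    have t: "awalk u ?t u" using qs e by (simp add: awalk_Cons_iff)
    have sign: "w a \<in> {1, -1}" if "a \<in> set ?t \<union> set r" for a
      using that by (intro less.prems(3)) (auto simp: p qrs)
    obtain c1 where c1: "cycle c1" "prod_list (map w r) = -1 \<longrightarrow> prod_list (map w c1) = -1"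
      using less.hyps[OF _ v] sign qrs(2) by (auto simp: p qrs)
    obtain c2 where c2: "cycle c2" "prod_list (map w ?t) = -1 \<longrightarrow> prod_list (map w c2) = -1"
      using less.hyps[OF _ t] sign qrs(2) by (auto simp: p qrs)
    \<comment> \<open>If the total product is -1, then either \<open>r\<close> has product -1 and
      \<open>c1\<close> is used, or \<open>r\<close> has product 1, the remainder has product -1,
      and \<open>c2\<close> is used.\<close>
    have "prod_list (map w r) \<in> {1, -1}"
    proof -
      have "\<forall>a\<in>set l. w a \<in> {1, -1} \<Longrightarrow> prod_list (map w l) \<in> {1, -1}" for l
        by (induction l) auto
      then show ?thesis using sign by blast
    qed
    moreover have "prod_list (map w p) = prod_list (map w r) * prod_list (map w ?t)"
      by (simp add: p qrs mult_ac)
    ultimately show ?thesis using c1 c2 by auto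
  qed
qed

text \<open>As \<pi> need not be injective, the image of an elementary cycle may revisit vertices,
  so it is treated as a closed walk. General signed digraphs are allowed in order to cover local and
  global graphs alike.\<close>

lemma cycle_projection:
  fixes G :: "'a signed_digraph" and H :: "'c signed_digraph" and \<pi> :: "'a \<Rightarrow> 'c"
  assumes "wf_digraph G" and "wf_digraph H"
    and ends: "tail G = (\<lambda>(j, s, i). j)" "head G = (\<lambda>(j, s, i). i)"
      "tail H = (\<lambda>(j, s, i). j)" "head H = (\<lambda>(j, s, i). i)"
    and verts: "\<And>j. j \<in> verts G \<Longrightarrow> \<pi> j \<in> verts H"
    and arcs: "\<And>j s i. (j, s, i) \<in> arcs G \<Longrightarrow> s \<in> {1, -1} \<and> (\<pi> j, s, \<pi> i) \<in> arcs H"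
  shows "(has_cycle G \<longrightarrow> has_cycle H) \<and> (has_negative_cycle G \<longrightarrow> has_negative_cycle H)"
proof -
  interpret G: wf_digraph G by fact
  interpret H: wf_digraph H by fact
  let ?\<phi> = "\<lambda>(j, s, i). (\<pi> j, s, \<pi> i)"
  let ?w = "\<lambda>(j, s, i). s"
  have walk: "H.awalk (\<pi> u) (map ?\<phi> p) (\<pi> v)" if "G.awalk u p v" for u p v
    using that
    by (induction p arbitrary: u)
      (auto simp: G.awalk_simps H.awalk_simps ends verts dest: arcs)
  have "\<exists>c. H.cycle c \<and> (cycle_sign p = -1 \<longrightarrow> cycle_sign c = -1)" if cycle: "G.cycle p" for p
  proof -
    obtain u where u: "G.awalk u p u" and ne: "p \<noteq> []"
      using cycle by (auto simp: G.cycle_def)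
    have "set p \<subseteq> arcs G" using u by (auto simp: G.awalk_def)
    then have "?w a \<in> {1, -1}" if "a \<in> set (map ?\<phi> p)" for a
      using that arcs by fastforce
    moreover have "map ?\<phi> p \<noteq> []" using ne by simp
    moreover have "map ?w (map ?\<phi> p) = map ?w p" by auto
    ultimately show ?thesis
      using H.closed_walk_imp_cycle_sign[OF walk[OF u], of ?w] unfolding cycle_sign_def by metis
  qed
  then show ?thesis unfolding has_cycle_def has_negative_cycle_def by blast
qed

lemma wf_digraph_local: "wf_digraph (local_interaction_graph J Y g x)"
  by unfold_locales (auto simp: local_interaction_graph_def)

lemma wf_digraph_global: "wf_digraph (global_interaction_graph J Y g)"
  by unfold_locales (auto simp: global_interaction_graph_def local_interaction_graph_def)

lemma local_arc_iff:
  "(j, s, i) \<in> arcs (local_interaction_graph J Y g x) \<longleftrightarrow>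
    j \<in> J \<and> i \<in> J \<and> (\<exists>s1\<in>{-1, 1}. shift J x s1 j \<in> Y \<and>
      s = s1 * sgn (g (shift J x s1 j) i - g x i) \<and> s \<noteq> 0)"
  by (simp add: local_interaction_graph_def)

lemma local_arc_sign:
  "(j, s, i) \<in> arcs (local_interaction_graph J Y g x) \<Longrightarrow> s \<in> {1, -1}"
  by (auto simp: local_arc_iff sgn_if split: if_splits)

text \<open>Replaces the choice in \<open>inv_into\<close> by explicit row sums: \<open>psi\<close>
  is \<open>beta\<close> of the row sums, which lie in the state space, where \<open>beta\<close> is
  injective.\<close>

lemma beta_inv_psi:
  assumes "y \<in> bool_space n m"
  shows "beta_inv n m (psi n m y) = (\<lambda>i\<in>{1..n}. \<Sum>k=1..m i. y (i, k))"
  unfolding beta_inv_def psi_eq_beta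
  using bij_betw_beta[of n m] row_sums_in_state_space[OF assms]
  by (auto simp: bij_betw_def intro: inv_into_f_f)

lemma row_sums_shift:
  assumes "(i, j) \<in> bool_index n m"
  shows "(\<lambda>a\<in>{1..n}. \<Sum>k=1..m a. shift (bool_index n m) y s (i, j) (a, k)) =
    shift {1..n} (\<lambda>a\<in>{1..n}. \<Sum>k=1..m a. y (a, k)) s i"
proof (rule ext)
  fix a
  show "(\<lambda>a\<in>{1..n}. \<Sum>k=1..m a. shift (bool_index n m) y s (i, j) (a, k)) a =
    shift {1..n} (\<lambda>a\<in>{1..n}. \<Sum>k=1..m a. y (a, k)) s i a"
  proof (cases "a \<in> {1..n}")
    case True
    \<comment> \<open>Testing \<open>k = j\<close> outermost gives the summand the shape of a
      single-point sum, which collapses because \<open>j\<close> lies in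
      \<open>{1..m i}\<close>.\<close>
    then have "(\<Sum>k=1..m a. shift (bool_index n m) y s (i, j) (a, k)) =
        (\<Sum>k=1..m a. y (a, k) + (if k = j then if a = i then s else 0 else 0))"
      by (intro sum.cong) (auto simp: shift_def unit_vector_def bool_index_def)
    also have "\<dots> = (\<Sum>k=1..m a. y (a, k)) + (if a = i then s else 0)"
      using assms by (auto simp: sum.distrib bool_index_def)
    finally show ?thesis using True by (auto simp: shift_def unit_vector_def)
  qed (auto simp: shift_def)
qed

lemma local_arc_projection:
  assumes y: "y \<in> bool_space n m"
    and arc: "(p, s, q) \<in> arcs (local_interaction_graph (bool_index n m) (bool_space n m)
      (boolean_map n m f) y)"
  shows "(fst p, s, fst q) \<in> arcs (local_interaction_graph {1..n} (state_space n m) f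
    (beta_inv n m (psi n m y)))"
proof -
  obtain i j where p: "p = (i, j)" by (cases p)
  obtain k l where q: "q = (k, l)" by (cases q)
  let ?x = "beta_inv n m (psi n m y)"
  let ?y' = "\<lambda>s. shift (bool_index n m) y s (i, j)"
  from arc obtain s1 where idx: "(i, j) \<in> bool_index n m" "(k, l) \<in> bool_index n m"
    and s1: "s1 \<in> {-1, 1}"
    and y': "?y' s1 \<in> bool_space n m"
    and s: "s = s1 * sgn (boolean_map n m f (?y' s1) (k, l) - boolean_map n m f y (k, l))" "s \<noteq> 0"
    unfolding local_arc_iff p q by (elim conjE bexE) (rule that)
  have x': "beta_inv n m (psi n m (?y' s1)) = shift {1..n} ?x s1 i"
    unfolding beta_inv_psi[OF y] beta_inv_psi[OF y'] by (rule row_sums_shift[OF idx(1)])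
  \<comment> \<open>The step cannot leave the state space: its result is the vector of row sums of
    the Boolean state \<open>?y' s1\<close>.\<close>
  have mem: "shift {1..n} ?x s1 i \<in> state_space n m"
    unfolding x'[symmetric] beta_inv_psi[OF y'] by (rule row_sums_in_state_space[OF y'])
  have "boolean_map n m f z (k, l) = (if f (beta_inv n m (psi n m z)) k \<ge> int l then 1 else 0)" for z
    using idx(2) by (simp add: boolean_map_def beta_def)
  \<comment> \<open>Since \<open>s\<close> is nonzero, the threshold \<open>l\<close> separates the
    two values of \<open>f\<close> in coordinate \<open>k\<close>, so their difference has the sign
    of the difference of the two bits.\<close>
  then have "s = s1 * sgn (f (shift {1..n} ?x s1 i) k - f ?x k)"
    using s by (auto simp: x' sgn_if split: if_splits)
  moreover have "i \<in> {1..n}" "k \<in> {1..n}" using idx by (auto simp: bool_index_def)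
  ultimately show ?thesis unfolding local_arc_iff p q fst_conv using s1 s(2) mem by blast
qed

theorem theorem2:
  fixes n :: nat and m :: "nat \<Rightarrow> nat" and f :: "(nat \<Rightarrow> int) \<Rightarrow> (nat \<Rightarrow> int)"
  assumes "\<And>i. i \<in> {1..n} \<Longrightarrow> m i \<ge> 1"
    and "f \<in> state_space n m \<rightarrow> state_space n m"
  shows
    "(\<forall>y \<in> bool_space n m.
       (has_cycle (local_interaction_graph (bool_index n m) (bool_space n m) (boolean_map n m f) y)
          \<longrightarrow> has_cycle (local_interaction_graph {1..n} (state_space n m) f
                (beta_inv n m (psi n m y)))) \<and>
       (has_negative_cycle
          (local_interaction_graph (bool_index n m) (bool_space n m) (boolean_map n m f) y)
          \<longrightarrow> has_negative_cycle (local_interaction_graph {1..n} (state_space n m) f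
                (beta_inv n m (psi n m y))))) \<and>
     (has_cycle (global_interaction_graph (bool_index n m) (bool_space n m) (boolean_map n m f))
       \<longrightarrow> has_cycle (global_interaction_graph {1..n} (state_space n m) f)) \<and>
     (has_negative_cycle
         (global_interaction_graph (bool_index n m) (bool_space n m) (boolean_map n m f))
       \<longrightarrow> has_negative_cycle (global_interaction_graph {1..n} (state_space n m) f))"
proof (intro conjI[OF ballI])
  fix y assume y: "y \<in> bool_space n m"
  show "(has_cycle (local_interaction_graph (bool_index n m) (bool_space n m) (boolean_map n m f) y)
          \<longrightarrow> has_cycle (local_interaction_graph {1..n} (state_space n m) f
                (beta_inv n m (psi n m y)))) \<and>
       (has_negative_cycle
          (local_interaction_graph (bool_index n m) (bool_space n m) (boolean_map n m f) y)
          \<longrightarrow> has_negative_cycle (local_interaction_graph {1..n} (state_space n m) f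
                (beta_inv n m (psi n m y))))"
  \<comment> \<open>Under \<open>fst\<close> an arc within one row becomes a loop, which counts as a
    cycle.\<close>
  proof (rule cycle_projection[OF wf_digraph_local wf_digraph_local, where \<pi> = fst])
    fix j s i
    assume arc: "(j, s, i) \<in> arcs (local_interaction_graph (bool_index n m) (bool_space n m)
      (boolean_map n m f) y)"
    show "s \<in> {1, -1} \<and> (fst j, s, fst i) \<in>
        arcs (local_interaction_graph {1..n} (state_space n m) f (beta_inv n m (psi n m y)))"
      using local_arc_sign[OF arc] local_arc_projection[OF y arc] ..
  qed (auto simp: local_interaction_graph_def bool_index_def)
next
  show "(has_cycle (global_interaction_graph (bool_index n m) (bool_space n m) (boolean_map n m f))
       \<longrightarrow> has_cycle (global_interaction_graph {1..n} (state_space n m) f)) \<and>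
     (has_negative_cycle
         (global_interaction_graph (bool_index n m) (bool_space n m) (boolean_map n m f))
       \<longrightarrow> has_negative_cycle (global_interaction_graph {1..n} (state_space n m) f))"
  proof (rule cycle_projection[OF wf_digraph_global wf_digraph_global, where \<pi> = fst])
    fix j s i
    assume "(j, s, i) \<in> arcs (global_interaction_graph (bool_index n m) (bool_space n m)
      (boolean_map n m f))"
    then obtain y where y: "y \<in> bool_space n m"
      and arc: "(j, s, i) \<in> arcs (local_interaction_graph (bool_index n m) (bool_space n m)
        (boolean_map n m f) y)"
      by (auto simp: global_interaction_graph_def)
    \<comment> \<open>The arcs of the global graph are collected only over base points in the state
      space.\<close>
    have "beta_inv n m (psi n m y) \<in> state_space n m"
      using row_sums_in_state_space[OF y] by (simp add: beta_inv_psi[OF y])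
    then show "s \<in> {1, -1} \<and>
        (fst j, s, fst i) \<in> arcs (global_interaction_graph {1..n} (state_space n m) f)"
      using local_arc_sign[OF arc] local_arc_projection[OF y arc]
      by (auto simp: global_interaction_graph_def)
  qed (auto simp: global_interaction_graph_def bool_index_def)
qed

end
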